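(* For any field $\mathbb{F}$, $l_0(M_3(\mathbb{F}))=4$; that is, the maximum of $l_0(\mathcal S)$ over all finite generating sets $\mathcal S$ of $M_3(\mathbb{F})$ equals $4$.
   Context: For a finite subset $\mathcal S$ of $M_n(\mathbb{F})$: a word of length $m$ in $\mathcal S$ is a product $S_1\cdots S_m$ with $S_j\in\mathcal S$. $\mathcal L_k^0(\mathcal S)$ is the linear span of all words of length between $1$ and $k$ (the identity is not automatically included). $\mathcal S$ is a generating set of $M_n(\mathbb{F})$ if the algebra it generates is $M_n(\mathbb{F})$. $l_0(\mathcal S)$ is the smallest $k$ with $\mathcal L_k^0(\mathcal S)=\mathcal L_{k+1}^0(\mathcal S)$, and $l_0(M_n(\mathbb{F}))$ is the maximum of $l_0(\mathcal S)$ over all finite generating sets $\mathcal S$ of $M_n(\mathbb{F})$. *)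

theory Defs
  imports "HOL-Analysis.Finite_Cartesian_Product" "HOL-Library.Numeral_Type"
begin

definition msmult :: "'a::times \<Rightarrow> 'a^'n^'m \<Rightarrow> 'a^'n^'m" where
  "msmult c M = (\<chi> i j. c * M $ i $ j)"

definition mspan :: "('a::field^'n^'m) set \<Rightarrow> ('a^'n^'m) set" where
  "mspan X = {M. \<exists>W c. finite W \<and> W \<subseteq> X \<and> M = (\<Sum>w\<in>W. msmult (c w) w)}"

text \<open>Words of length exactly m (m \<ge> 1) in S; words_len S 0 is empty (the identity is not a word).\<close>
fun words_len :: "('a::semiring_1^'n^'n) set \<Rightarrow> nat \<Rightarrow> ('a^'n^'n) set" where
  "words_len S 0 = {}"
| "words_len S (Suc 0) = S"
| "words_len S (Suc (Suc m)) = {A ** B | A B. A \<in> S \<and> B \<in> words_len S (Suc m)}"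

definition L0 :: "('a::field^'n^'n) set \<Rightarrow> nat \<Rightarrow> ('a^'n^'n) set" where
  "L0 S k = mspan (\<Union>m\<in>{1..k}. words_len S m)"

inductive_set gen_alg :: "('a::field^'n^'n) set \<Rightarrow> ('a^'n^'n) set" for S where
  base: "A \<in> S \<Longrightarrow> A \<in> gen_alg S"
| one: "mat 1 \<in> gen_alg S"
| zero: "0 \<in> gen_alg S"
| add: "A \<in> gen_alg S \<Longrightarrow> B \<in> gen_alg S \<Longrightarrow> A + B \<in> gen_alg S"
| smult: "A \<in> gen_alg S \<Longrightarrow> msmult c A \<in> gen_alg S"
| mult: "A \<in> gen_alg S \<Longrightarrow> B \<in> gen_alg S \<Longrightarrow> A ** B \<in> gen_alg S"

definition generating_set :: "('a::field^'n^'n) set \<Rightarrow> bool" where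
  "generating_set S \<longleftrightarrow> gen_alg S = UNIV"

definition l0 :: "('a::field^'n^'n) set \<Rightarrow> nat" where
  "l0 S = (LEAST k. L0 S k = L0 S (Suc k))"

end

(* Let E_k and V_k be the spans of the words of length at most k with and without the identity.
   If E_k (k >= 2) exceeds E_(k-1) by one dimension only, then E_(k+1) = E_k: otherwise some power
   x^(k+1) of a letter lies outside E_k, contradicting Cayley-Hamilton. The same holds for V_k if
   k >= 3. As S contains non-commuting matrices, dim E_1 >= 3, hence dim E_4 = 9.

   If V_4 is not the full matrix algebra, then it does not contain the identity, and counting
   dimensions gives dim V_2 <= 4 and V_1 = span {A, B}. Since V_3 does not contain the identity,
   polarized Cayley-Hamilton makes the pencil x A + y B identically singular, with its adjugate as
   a nonzero quadratic null vector. By irreducibility there is then a linear null vector, and the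
   matrices A, B, AA, AB, BA turn out to be linearly independent, contradicting dim V_2 <= 4. *)

theory Submission
  imports Defs "HOL-Analysis.Cartesian_Space"
begin

subsection \<open>The vector space of matrices\<close>

definition matrix_unit :: "'m \<Rightarrow> 'n \<Rightarrow> 'a::zero_neq_one^'n^'m" where
  "matrix_unit i j = (\<chi> k l. if k = i \<and> l = j then 1 else 0)"

lemma matrix_unit_nth: "matrix_unit i j $ k $ l = (if k = i \<and> l = j then 1 else 0)"
  by (simp add: matrix_unit_def)

lemma msmult_nth [simp]: "msmult c M $ i $ j = c * M $ i $ j"
  by (simp add: msmult_def)

lemma matrix_unit_mult:
  "matrix_unit i j ** matrix_unit k l = (if j = k then matrix_unit i l else (0 :: 'a::semiring_1^'n^'m))"
proof -
  have "(\<Sum>x\<in>UNIV. (if u = i \<and> x = j then 1 else 0) * (if x = k \<and> v = l then 1 else 0)) =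
      (if u = i \<and> j = k \<and> v = l then 1 else (0::'a))" for u v
  proof -
    have "(if u = i \<and> x = j then 1 else 0) * (if x = k \<and> v = l then 1 else 0) =
        (if x = j then (if u = i \<and> j = k \<and> v = l then 1 else 0) else (0::'a))" for x
      by auto
    then show ?thesis
      by (simp add: sum.delta)
  qed
  then show ?thesis
    by (auto simp: vec_eq_iff matrix_matrix_mult_def matrix_unit_def)
qed

lemma matrix_eq_sum_matrix_unit:
  "M = (\<Sum>i\<in>UNIV. \<Sum>j\<in>UNIV. msmult (M $ i $ j) (matrix_unit i j))" for M :: "'a::field^'n^'m"
proof -
  have "(\<Sum>j\<in>UNIV. M $ i $ j * (if k = i \<and> l = j then 1 else 0)) = (if k = i then M $ i $ l else 0)"
    for i k l
    by (cases "k = i") (simp_all add: if_distrib cong: if_cong)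
  then show ?thesis
    by (simp add: vec_eq_iff matrix_unit_nth)
qed

definition matrix_units :: "('a::zero_neq_one^'n^'m) set" where
  "matrix_units = range (\<lambda>(i, j). matrix_unit i j)"

lemma inj_matrix_unit: "inj (\<lambda>(i, j). matrix_unit i j :: 'a::zero_neq_one^'n^'m)"
proof (rule injI, clarify)
  fix i j k l
  assume "(matrix_unit i j :: 'a^'n^'m) = matrix_unit k l"
  then have "(matrix_unit i j :: 'a^'n^'m) $ i $ j = matrix_unit k l $ i $ j"
    by simp
  then show "i = k \<and> j = l"
    by (simp add: matrix_unit_nth split: if_splits)
qed

text \<open>Scalars are field elements acting through \<open>msmult\<close>; \<open>*s\<close> on
  \<open>'a^'n^'m\<close> would take its scalars from the row type \<open>'a^'n\<close>.\<close>

interpretation matrix: vector_space "msmult :: 'a::field \<Rightarrow> 'a^'n^'m \<Rightarrow> 'a^'n^'m"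
  by unfold_locales (auto simp: vec_eq_iff algebra_simps)

interpretation matrix: finite_dimensional_vector_space
  "msmult :: 'a::field \<Rightarrow> 'a^'n^'m \<Rightarrow> 'a^'n^'m" matrix_units
proof
  show "finite (matrix_units :: ('a^'n^'m) set)"
    by (simp add: matrix_units_def)
next
  show "matrix.independent (matrix_units :: ('a^'n^'m) set)"
  proof
    assume "matrix.dependent (matrix_units :: ('a^'n^'m) set)"
    then obtain T u v where T: "finite T" "T \<subseteq> (matrix_units :: ('a^'n^'m) set)"
      "(\<Sum>w\<in>T. msmult (u w) w) = 0" "v \<in> T" "u v \<noteq> 0"
      unfolding matrix.dependent_explicit by auto
    obtain i j where v: "v = matrix_unit i j"
      using T(2,4) by (auto simp: matrix_units_def)
    have "(\<Sum>w\<in>T. msmult (u w) w) $ i $ j = (\<Sum>w\<in>T. u w * w $ i $ j)"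
      by simp
    \<comment> \<open>Distinct matrix units have disjoint supports, so the entry at
      \<open>(i, j)\<close> isolates the coefficient of \<open>v\<close>.\<close>
    also have "\<dots> = (\<Sum>w\<in>T. if w = v then u v else 0)"
    proof (rule sum.cong)
      fix w assume "w \<in> T"
      then obtain k l where "w = matrix_unit k l"
        using T(2) by (auto simp: matrix_units_def)
      then show "u w * w $ i $ j = (if w = v then u v else 0)"
        unfolding v using injD[OF inj_matrix_unit, of "(k, l)" "(i, j)"]
        by (auto simp: matrix_unit_nth)
    qed simp
    also have "\<dots> = u v"
      using T by simp
    finally show False
      using T by simp
  qed
next
  have "M \<in> matrix.span matrix_units" for M :: "'a^'n^'m"
    by (subst matrix_eq_sum_matrix_unit, intro matrix.span_sum matrix.span_scale matrix.span_base)
      (auto simp: matrix_units_def)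
  then show "matrix.span matrix_units = (UNIV :: ('a^'n^'m) set)"
    by auto
qed

lemma dim_matrix_UNIV: "matrix.dim (UNIV :: ('a::field^'n^'m) set) = CARD('m) * CARD('n)"
  using card_image[OF inj_matrix_unit] by (simp add: matrix_units_def)

lemma mspan_eq_span: "mspan X = matrix.span X"
  unfolding mspan_def matrix.span_explicit by auto

lemma msmult_mult_left: "msmult c A ** B = msmult c (A ** B)" for c :: "'a::field"
  by (simp add: vec_eq_iff matrix_matrix_mult_def sum_distrib_left mult_ac)

lemma msmult_mult_right: "A ** msmult c B = msmult c (A ** B)" for c :: "'a::field"
  by (simp add: vec_eq_iff matrix_matrix_mult_def sum_distrib_left mult_ac)

lemma msmult_mult_vec: "msmult c A *v x = c *s (A *v x)" for c :: "'a::field"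
  by (simp add: vec_eq_iff matrix_vector_mult_def sum_distrib_left mult_ac)

lemmas msmult_mult = msmult_mult_left msmult_mult_right

lemma matrix_add_rdistrib: "(A + B) ** C = A ** C + B ** C" for A B :: "'a::semiring_1^'n^'m"
  by (simp add: vec_eq_iff matrix_matrix_mult_def sum.distrib distrib_right)

lemma matrix_sub_ldistrib: "A ** (B - C) = A ** B - A ** C" for B C :: "'a::ring_1^'n^'m"
  by (simp add: vec_eq_iff matrix_matrix_mult_def sum_subtractf right_diff_distrib)

lemma zero_matrix_mult [simp]: "(0 :: 'a::semiring_1^'n^'m) ** (X :: 'a^'k^'n) = 0"
  by (simp add: vec_eq_iff matrix_matrix_mult_def)

text \<open>Multiplication by a fixed matrix is linear, so membership in a subspace need only be
  tested on the spanning set.\<close>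

lemma span_mult_left_mem:
  assumes "M \<in> matrix.span X" "matrix.subspace T" "\<And>N. N \<in> X \<Longrightarrow> A ** N \<in> T"
  shows "A ** M \<in> (T :: ('a::field^'n^'m) set)"
  using assms(1)
proof (induction rule: matrix.span_induct_alt)
  case base
  then show ?case using assms(2) by (simp add: matrix.subspace_0)
next
  case (step c x y)
  then show ?case
    using assms by (simp add: matrix_add_ldistrib msmult_mult matrix.subspace_add matrix.subspace_scale)
qed

lemma span_mult_right_mem:
  assumes "M \<in> matrix.span X" "matrix.subspace T" "\<And>N. N \<in> X \<Longrightarrow> N ** A \<in> T"
  shows "M ** A \<in> (T :: ('a::field^'n^'m) set)"
  using assms(1)
proof (induction rule: matrix.span_induct_alt)
  case base
  then show ?case using assms(2) by (simp add: matrix.subspace_0)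
next
  case (step c x y)
  then show ?case
    using assms by (simp add: matrix_add_rdistrib msmult_mult matrix.subspace_add matrix.subspace_scale)
qed

subsection \<open>Spans of words\<close>

definition word_prod :: "('a::semiring_1^'n^'n) list \<Rightarrow> 'a^'n^'n" where
  "word_prod ws = foldr (**) ws (mat 1)"

lemma word_prod_Nil [simp]: "word_prod [] = mat 1"
  and word_prod_Cons [simp]: "word_prod (x # ws) = x ** word_prod ws"
  by (simp_all add: word_prod_def)

lemma word_prod_append: "word_prod (us @ ws) = word_prod us ** word_prod ws"
  by (induction us) (simp_all add: matrix_mul_assoc)

text \<open>The lower bound \<open>a\<close> on the length distinguishes the spaces with identity (\<open>a = 0\<close>)
  from those without (\<open>a = 1\<close>).\<close>

definition word_span :: "nat \<Rightarrow> ('a::field^'n^'n) set \<Rightarrow> nat \<Rightarrow> ('a^'n^'n) set" where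
  "word_span a S k =
    matrix.span {word_prod ws | ws. set ws \<subseteq> S \<and> a \<le> length ws \<and> length ws \<le> k}"

text \<open>Restricted to positive lengths: the empty list has product \<open>mat 1\<close>, whereas
  \<open>words_len S 0\<close> is empty.\<close>

lemma words_len_Suc: "words_len S (Suc m) = {word_prod ws | ws. set ws \<subseteq> S \<and> length ws = Suc m}"
proof (induction m)
  case 0
  have "ws = [] \<or> (\<exists>x. ws = [x])" if "length ws = 1" for ws :: "('a^'n^'n) list"
    using that by (cases ws) auto
  then show ?case
    by (auto simp: length_Suc_conv intro: exI[of _ "[_]"])
next
  case (Suc m)
  show ?case
  proof (intro subset_antisym subsetI)
    fix M assume "M \<in> words_len S (Suc (Suc m))"
    then obtain A ws where "A \<in> S" "set ws \<subseteq> S" "length ws = Suc m" "M = A ** word_prod ws"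
      using Suc by auto
    then show "M \<in> {word_prod ws | ws. set ws \<subseteq> S \<and> length ws = Suc (Suc m)}"
      by (auto intro!: exI[of _ "A # ws"])
  next
    fix M assume "M \<in> {word_prod ws | ws. set ws \<subseteq> S \<and> length ws = Suc (Suc m)}"
    then obtain ws where "set ws \<subseteq> S" "length ws = Suc (Suc m)" "M = word_prod ws"
      by auto
    then obtain A ws' where "A \<in> S" "set ws' \<subseteq> S" "length ws' = Suc m" "M = A ** word_prod ws'"
      by (cases ws) auto
    then show "M \<in> words_len S (Suc (Suc m))"
      using Suc by auto
  qed
qed

lemma L0_eq_word_span: "L0 S k = word_span 1 S k"
proof -
  have "words_len S m = {word_prod ws | ws. set ws \<subseteq> S \<and> length ws = m}" if "m \<in> {1..k}" for m
    using that words_len_Suc[of S "m - 1"] by auto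
  then have "(\<Union>m\<in>{1..k}. words_len S m) =
      {word_prod ws | ws. set ws \<subseteq> S \<and> 1 \<le> length ws \<and> length ws \<le> k}"
    by auto
  then show ?thesis
    by (simp add: L0_def mspan_eq_span word_span_def)
qed

lemma subspace_word_span: "matrix.subspace (word_span a S k)"
  by (simp add: word_span_def)

lemma span_word_span [simp]: "matrix.span (word_span a S k) = word_span a S k"
  by (simp add: word_span_def)

lemma word_prod_in_word_span:
  "set ws \<subseteq> S \<Longrightarrow> a \<le> length ws \<Longrightarrow> length ws \<le> k \<Longrightarrow> word_prod ws \<in> word_span a S k"
  unfolding word_span_def by (rule matrix.span_base) auto

lemma word_span_leI:
  assumes "matrix.subspace T"
    and "\<And>ws. set ws \<subseteq> S \<Longrightarrow> a \<le> length ws \<Longrightarrow> length ws \<le> k \<Longrightarrow> word_prod ws \<in> T"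
  shows "word_span a S k \<subseteq> T"
  unfolding word_span_def using assms by (intro matrix.span_minimal) auto

lemma word_span_mono: "b \<le> a \<Longrightarrow> k \<le> l \<Longrightarrow> word_span a S k \<subseteq> word_span b S l"
  by (intro word_span_leI subspace_word_span word_prod_in_word_span) auto

lemma word_span_mult_left:
  assumes "x \<in> S" "M \<in> word_span a S k" shows "x ** M \<in> word_span a S (Suc k)"
  using assms(2) unfolding word_span_def[of a S k]
proof (rule span_mult_left_mem)
  fix N assume "N \<in> {word_prod ws | ws. set ws \<subseteq> S \<and> a \<le> length ws \<and> length ws \<le> k}"
  then obtain ws where "N = word_prod ws" "set ws \<subseteq> S" "a \<le> length ws" "length ws \<le> k"
    by auto
  then show "x ** N \<in> word_span a S (Suc k)"
    using word_prod_in_word_span[of "x # ws" S a "Suc k"] assms(1) by simp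
qed (rule subspace_word_span)

lemma word_span_mult_right:
  assumes "x \<in> S" "M \<in> word_span a S k" shows "M ** x \<in> word_span a S (Suc k)"
  using assms(2) unfolding word_span_def[of a S k]
proof (rule span_mult_right_mem)
  fix N assume "N \<in> {word_prod ws | ws. set ws \<subseteq> S \<and> a \<le> length ws \<and> length ws \<le> k}"
  then obtain ws where "N = word_prod ws" "set ws \<subseteq> S" "a \<le> length ws" "length ws \<le> k"
    by auto
  then show "N ** x \<in> word_span a S (Suc k)"
    using word_prod_in_word_span[of "ws @ [x]" S a "Suc k"] assms(1)
    by (simp add: word_prod_append)
qed (rule subspace_word_span)

text \<open>Only the empty word separates the two families. The dimensions thus differ by one
  exactly when the identity lies outside \<open>word_span 1 S k\<close>.\<close>

lemma word_span_0_eq: "word_span 0 S k = matrix.span (insert (mat 1) (word_span 1 S k))"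
proof (rule subset_antisym)
  show "word_span 0 S k \<subseteq> matrix.span (insert (mat 1) (word_span 1 S k))"
  proof (rule word_span_leI)
    fix ws assume "set ws \<subseteq> S" "length ws \<le> k"
    then show "word_prod ws \<in> matrix.span (insert (mat 1) (word_span 1 S k))"
      using word_prod_in_word_span[of ws S 1 k]
      by (cases ws) (auto intro: matrix.span_base)
  qed simp
  have "mat 1 \<in> word_span 0 S k"
    using word_prod_in_word_span[of "[]" S 0 k] by simp
  then show "matrix.span (insert (mat 1) (word_span 1 S k)) \<subseteq> word_span 0 S k"
    by (intro matrix.span_minimal subspace_word_span) (use word_span_mono[of 0 1 k k S] in auto)
qed

text \<open>A stable span is closed under left multiplication by letters, hence by everything they
  generate; for generating \<open>S\<close> it is a left ideal.\<close>

lemma word_span_Suc_eq_left_ideal: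
  assumes eq: "word_span a S (Suc k) = word_span a S k" and "M \<in> gen_alg S" "N \<in> word_span a S k"
  shows "M ** N \<in> word_span a S k"
  using assms(2,3)
proof (induction arbitrary: N rule: gen_alg.induct)
  case (base A)
  then show ?case using word_span_mult_left[of A S N a k] eq by simp
next
  case zero
  then show ?case by (simp add: matrix.subspace_0 subspace_word_span)
next
  case (add A B)
  then show ?case by (simp add: matrix_add_rdistrib matrix.subspace_add subspace_word_span)
next
  case (smult A c)
  then show ?case by (simp add: msmult_mult matrix.subspace_scale subspace_word_span)
next
  case (mult A B)
  then show ?case by (simp flip: matrix_mul_assoc)
qed simp

lemma word_span_0_stable:
  assumes "word_span 0 S (Suc k) = word_span 0 S k" "generating_set S"
  shows "word_span 0 S k = UNIV"
proof -
  have "M ** mat 1 \<in> word_span 0 S k" for M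
    using assms word_prod_in_word_span[of "[]" S 0 k]
    by (intro word_span_Suc_eq_left_ideal) (auto simp: generating_set_def)
  then show ?thesis
    by auto
qed

text \<open>Deleting the first letter of a word of length \<open>k + 2\<close> leaves length
  \<open>k + 1\<close>; \<open>a <= Suc k\<close> keeps that word admissible.\<close>

lemma word_span_stable_Suc:
  assumes "a \<le> Suc k" and eq: "word_span a S (Suc k) = word_span a S k"
  shows "word_span a S (Suc (Suc k)) = word_span a S (Suc k)"
proof (rule subset_antisym)
  show "word_span a S (Suc (Suc k)) \<subseteq> word_span a S (Suc k)"
  proof (rule word_span_leI)
    fix ws assume ws: "set ws \<subseteq> S" "a \<le> length ws" "length ws \<le> Suc (Suc k)"
    show "word_prod ws \<in> word_span a S (Suc k)"
    proof (cases "length ws = Suc (Suc k)")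
      case True
      then obtain x us where "ws = x # us" "length us = Suc k"
        by (cases ws) auto
      then show ?thesis
        using ws assms(1) word_span_mult_left[of x S "word_prod us" a k]
          word_prod_in_word_span[of us S a "Suc k"] eq by simp
    next
      case False
      then show ?thesis
        using ws by (intro word_prod_in_word_span) auto
    qed
  qed (rule subspace_word_span)
qed (rule word_span_mono; simp)

lemma word_span_stable:
  assumes "a \<le> Suc k" "word_span a S (Suc k) = word_span a S k" "k \<le> l"
  shows "word_span a S l = word_span a S k"
proof -
  have "word_span a S l = word_span a S k \<and> word_span a S (Suc l) = word_span a S l"
    using assms(3)
  proof (induction l rule: dec_induct)
    case base
    then show ?case using assms by simp
  next
    case (step l)
    then show ?case using word_span_stable_Suc[of a l S] assms(1) by simp
  qed
  then show ?thesis ..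
qed

text \<open>If the span grows by only one dimension, then left multiplication by a suitable letter
  \<open>x\<close> maps no new element into the span. Moving letters of a word outside the span from its end
  to an \<open>x\<close> at its front then turns that word into a power of \<open>x\<close>.\<close>

lemma power_notin_word_span:
  fixes S :: "('a::field^'n^'n) set" and a :: nat
  defines "C \<equiv> word_span a S"
  assumes a: "a \<le> Suc j" and neq: "C (Suc (Suc j)) \<noteq> C (Suc j)"
    and dim: "matrix.dim (C (Suc j)) \<le> matrix.dim (C j) + 1"
  shows "\<exists>x\<in>S. word_prod (replicate (Suc (Suc j)) x) \<notin> C (Suc j)"
proof -
  have "\<not> C (Suc (Suc j)) \<subseteq> C (Suc j)"
    using neq word_span_mono[of a a "Suc j" "Suc (Suc j)" S] by (auto simp: C_def)
  then obtain ws where ws: "set ws \<subseteq> S" "a \<le> length ws" "length ws \<le> Suc (Suc j)"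
    "word_prod ws \<notin> C (Suc j)"
    unfolding C_def using word_span_leI[OF subspace_word_span] by metis
  with word_prod_in_word_span[of ws S a "Suc j"] have "length ws = Suc (Suc j)"
    by (metis C_def le_Suc_eq)
  then obtain x us where us: "ws = x # us" "length us = Suc j"
    by (cases ws) auto
  have x: "x \<in> S"
    using us ws by simp
  have us_in: "word_prod us \<in> C (Suc j)"
    unfolding C_def using us ws a by (intro word_prod_in_word_span) auto
  \<comment> \<open>By \<open>dim\<close>, \<open>Y\<close> and \<open>C j\<close> together span
    \<open>C (Suc j)\<close>. If \<open>x ** Y\<close> stayed inside, \<open>x\<close> would map all
    of \<open>C (Suc j)\<close> into itself, yet \<open>x ** word_prod us\<close> is the word
    \<open>ws\<close> outside it.\<close>
  have step: "x ** Y \<notin> C (Suc j)" if Y: "Y \<in> C (Suc j)" "Y \<notin> C j" for Y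
  proof
    assume xY: "x ** Y \<in> C (Suc j)"
    have "matrix.span (insert Y (C j)) = C (Suc j)"
    proof (rule matrix.subspace_dim_equal)
      show "matrix.span (insert Y (C j)) \<subseteq> C (Suc j)"
        using Y word_span_mono[of a a j "Suc j" S]
        by (intro matrix.span_minimal) (auto simp: C_def subspace_word_span)
      show "matrix.dim (C (Suc j)) \<le> matrix.dim (matrix.span (insert Y (C j)))"
        using dim Y by (simp add: matrix.dim_insert) (simp add: C_def)
    qed (simp_all add: C_def subspace_word_span)
    then have "word_prod us \<in> matrix.span (insert Y (C j))"
      using us_in by simp
    then have "x ** word_prod us \<in> C (Suc j)"
    proof (rule span_mult_left_mem)
      fix N assume "N \<in> insert Y (C j)"
      then show "x ** N \<in> C (Suc j)"
        using xY x word_span_mult_left by (auto simp: C_def)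
    qed (simp add: C_def subspace_word_span)
    then show False
      using ws us by simp
  qed
  have "\<exists>vs. length vs = Suc j - i \<and> set vs \<subseteq> S \<and>
      word_prod (replicate (Suc i) x @ vs) \<notin> C (Suc j)" if "i \<le> Suc j" for i
    using that
  proof (induction i)
    case 0
    then show ?case
      using us ws by (intro exI[of _ us]) auto
  next
    case (Suc i)
    then obtain vs where vs: "length vs = Suc j - i" "set vs \<subseteq> S"
      "word_prod (replicate (Suc i) x @ vs) \<notin> C (Suc j)"
      by auto
    obtain vs' s where vs': "vs = vs' @ [s]"
      using vs(1) Suc.prems by (cases vs rule: rev_cases) auto
    define Y where "Y = word_prod (replicate (Suc i) x @ vs')"
    have "Y ** s = word_prod (replicate (Suc i) x @ vs)"
      by (simp add: Y_def vs' word_prod_append matrix_mul_assoc)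
    \<comment> \<open>Otherwise appending the letter \<open>s\<close> would bring the longer word
      back into \<open>C (Suc j)\<close>.\<close>
    then have "Y \<notin> C j"
      using word_span_mult_right[of s S Y a j] vs vs' by (auto simp: C_def)
    moreover have "Y \<in> C (Suc j)"
      unfolding Y_def C_def using vs vs' Suc.prems x a
      by (intro word_prod_in_word_span) auto
    ultimately have "x ** Y \<notin> C (Suc j)"
      using step by simp
    then show ?case
      using vs vs' Suc.prems by (intro exI[of _ vs']) (auto simp: Y_def)
  qed
  from this[of "Suc j"] show ?thesis
    using x by auto
qed

subsection \<open>Cayley--Hamilton for pencils of \<open>3 \<times> 3\<close> matrices\<close>

definition trace_3 :: "'a::field^3^3 \<Rightarrow> 'a" where
  "trace_3 A = A$1$1 + A$2$2 + A$3$3"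

text \<open>The sum of the principal 2 by 2 minors, a coefficient of the characteristic
  polynomial.\<close>

definition minors_3 :: "'a::field^3^3 \<Rightarrow> 'a" where
  "minors_3 A = A$1$1 * A$2$2 - A$1$2 * A$2$1 + A$1$1 * A$3$3 - A$1$3 * A$3$1
     + A$2$2 * A$3$3 - A$2$3 * A$3$2"

text \<open>The classical adjugate, written as a polynomial in \<open>A\<close> so that
  \<open>A ** adj_3 A\<close> is visibly a combination of powers of \<open>A\<close> without
  constant term.\<close>

definition adj_3 :: "'a::field^3^3 \<Rightarrow> 'a^3^3" where
  "adj_3 A = A ** A - msmult (trace_3 A) A + msmult (minors_3 A) (mat 1)"

text \<open>The coefficient of \<open>x y\<close> in the adjugate of \<open>x A + y B\<close>; the last coefficient is the
  polarization of \<^const>\<open>minors_3\<close>.\<close>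

definition mixed_adj_3 :: "'a::field^3^3 \<Rightarrow> 'a^3^3 \<Rightarrow> 'a^3^3" where
  "mixed_adj_3 A B = A ** B + B ** A - msmult (trace_3 A) B - msmult (trace_3 B) A
     + msmult (minors_3 (A + B) - minors_3 A - minors_3 B) (mat 1)"

lemma mixed_adj_3_commute: "mixed_adj_3 A B = mixed_adj_3 B A"
  by (simp add: mixed_adj_3_def algebra_simps)

text \<open>The scalar is the determinant. Only its existence is needed, so it is read off at
  \<open>(1, 1)\<close> and the identity is checked entrywise.\<close>

lemma mult_adj_3: "\<exists>c. A ** adj_3 A = msmult c (mat 1)"
  by (rule exI[of _ "(A ** adj_3 A) $ 1 $ 1"])
    (simp add: vec_eq_iff forall_3 adj_3_def matrix_matrix_mult_def sum_3 mat_def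
      trace_3_def minors_3_def algebra_simps)

text \<open>This is the coefficient of \<open>x^2 y\<close> in the product of the pencil
  \<open>x A + y B\<close> with its adjugate, which is a scalar polynomial times the
  identity.\<close>

lemma mult_mixed_adj_3: "\<exists>c. A ** mixed_adj_3 A B + B ** adj_3 A = msmult c (mat 1)"
  by (rule exI[of _ "(A ** mixed_adj_3 A B + B ** adj_3 A) $ 1 $ 1"])
    (simp add: vec_eq_iff forall_3 adj_3_def mixed_adj_3_def matrix_matrix_mult_def sum_3 mat_def
      trace_3_def minors_3_def algebra_simps)

lemma cube_3: "\<exists>t s d. A ** (A ** A) = msmult t (A ** A) + msmult s A + msmult d (mat 1)"
  for A :: "'a::field^3^3"
proof -
  obtain d where "A ** adj_3 A = msmult d (mat 1)"
    using mult_adj_3 by blast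
  then have "A ** (A ** A) = msmult (trace_3 A) (A ** A) + msmult (- minors_3 A) A + msmult d (mat 1)"
    by (simp add: adj_3_def matrix_add_ldistrib matrix_sub_ldistrib msmult_mult algebra_simps)
  then show ?thesis
    by blast
qed

text \<open>With smaller growth, a power \<open>x^(k+1)\<close> of a letter would lie outside the
  span. Cayley-Hamilton reduces it to \<open>x^k\<close>, \<open>x^(k-1)\<close> and
  \<open>x^(k-2)\<close>; the bound \<open>a + 2 <= k\<close> makes even the last one an admissible
  word.\<close>

lemma dim_word_span_growth:
  fixes S :: "('a::field^3^3) set"
  assumes a: "a + 2 \<le> k" and neq: "word_span a S (Suc k) \<noteq> word_span a S k"
  shows "matrix.dim (word_span a S (k - 1)) + 2 \<le> matrix.dim (word_span a S k)"
proof (rule ccontr)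
  assume small: "\<not> ?thesis"
  obtain i where k: "k = Suc (Suc i)" and i: "a \<le> i"
    using a that[of "k - 2"] by auto
  then obtain x where x: "x \<in> S" "word_prod (replicate (Suc (Suc (Suc i))) x) \<notin> word_span a S k"
    using power_notin_word_span[of a "Suc i" S] neq small by auto
  define W where "W = word_prod (replicate i x)"
  obtain t s d where "x ** (x ** x) = msmult t (x ** x) + msmult s x + msmult d (mat 1)"
    using cube_3 by blast
  then have "word_prod (replicate (Suc (Suc (Suc i))) x) =
      (msmult t (x ** x) + msmult s x + msmult d (mat 1)) ** W"
    by (simp add: W_def matrix_mul_assoc)
  also have "\<dots> = msmult t (word_prod (replicate (Suc (Suc i)) x)) +
      msmult s (word_prod (replicate (Suc i) x)) + msmult d (word_prod (replicate i x))"
    by (simp add: W_def matrix_add_rdistrib msmult_mult matrix_mul_assoc)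
  also have "\<dots> \<in> word_span a S k"
    using x i unfolding k
    by (intro matrix.subspace_add matrix.subspace_scale subspace_word_span word_prod_in_word_span)
      (auto simp del: replicate.simps)
  finally show False
    using x by simp
qed

subsection \<open>Consequences of generating the full matrix algebra\<close>

lemma gen_alg_commute:
  fixes X M :: "'a::field^'n^'n"
  assumes "X \<in> gen_alg S" "\<And>A. A \<in> S \<Longrightarrow> A ** M = M ** A"
  shows "X ** M = M ** X"
  using assms
  by (induction rule: gen_alg.induct)
    (simp_all add: matrix_add_ldistrib matrix_add_rdistrib msmult_mult, metis matrix_mul_assoc)

text \<open>Commuting letters would make the whole algebra commutative, which
  \<open>matrix_unit 1 2\<close> and \<open>matrix_unit 2 1\<close> refute.\<close>

lemma generating_set_not_commuting:
  fixes S :: "('a::field^3^3) set"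
  assumes "generating_set S"
  obtains A B where "A \<in> S" "B \<in> S" "A ** B \<noteq> B ** A"
proof -
  have "\<exists>A\<in>S. \<exists>B\<in>S. A ** B \<noteq> B ** A"
  proof (rule ccontr)
    assume "\<not> ?thesis"
    then have "X ** A = A ** X" if "A \<in> S" for X A :: "'a^3^3"
      using gen_alg_commute[of X S A] that assms by (auto simp: generating_set_def)
    then have "X ** Y = Y ** X" for X Y :: "'a^3^3"
      using gen_alg_commute[of X S Y] assms by (simp add: generating_set_def)
    from this[of "matrix_unit 1 2" "matrix_unit 2 1"]
    have "(matrix_unit 1 1 :: 'a^3^3) = matrix_unit 2 2"
      by (simp add: matrix_unit_mult)
    then show False
      by (auto simp: matrix_unit_nth dest: arg_cong[where f = "\<lambda>M. M $ 1 $ 1"])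
  qed
  then show ?thesis
    using that by blast
qed

lemma subspace_centralizer: "matrix.subspace {X. X ** A = A ** X}" for A :: "'a::field^'n^'n"
  by (rule matrix.subspaceI) (simp_all add: matrix_add_ldistrib matrix_add_rdistrib msmult_mult)

text \<open>The span of \<open>mat 1\<close> commutes with \<open>B\<close>, and the span of
  \<open>A\<close> and \<open>mat 1\<close> commutes with \<open>A\<close>. The five facts are the
  side conditions for computing dimensions by \<open>matrix.dim_insert\<close>.\<close>

lemma not_commuting_independent:
  fixes A B :: "'a::field^'n^'n"
  assumes AB: "A ** B \<noteq> B ** A"
  shows "(mat 1 :: 'a^'n^'n) \<notin> matrix.span {}" "A \<notin> matrix.span {mat 1}" "B \<notin> matrix.span {A, mat 1}"
    "A \<notin> matrix.span {}" "B \<notin> matrix.span {A}"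
proof -
  have "matrix.span {mat 1} \<subseteq> {X. X ** B = B ** X}"
    by (rule matrix.span_minimal) (simp_all add: subspace_centralizer)
  then show A: "A \<notin> matrix.span {mat 1}"
    using AB by auto
  have "matrix.span {A, mat 1} \<subseteq> {X. X ** A = A ** X}"
    by (rule matrix.span_minimal) (simp_all add: subspace_centralizer)
  then show B: "B \<notin> matrix.span {A, mat 1}"
    using AB by auto
  then show "B \<notin> matrix.span {A}"
    using matrix.span_mono[of "{A}" "{A, mat 1}"] by auto
  show "A \<notin> matrix.span {}"
    using A matrix.span_mono[of "{}" "{mat 1}"] by auto
  have "(mat 1 :: 'a^'n^'n) \<noteq> 0"
  proof
    assume "(mat 1 :: 'a^'n^'n) = 0"
    then have "A = 0"
      by (metis matrix_mul_lid zero_matrix_mult)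
    then show False
      using AB by simp
  qed
  then show "(mat 1 :: 'a^'n^'n) \<notin> matrix.span {}"
    by simp
qed

lemma word_span_0_4_eq_UNIV:
  fixes S :: "('a::field^3^3) set"
  assumes gen: "generating_set S"
  shows "word_span 0 S 4 = UNIV"
proof (rule ccontr)
  assume not_UNIV: "word_span 0 S 4 \<noteq> UNIV"
  have neq: "word_span 0 S (Suc k) \<noteq> word_span 0 S k" if "k \<le> 4" for k
    using word_span_0_stable[OF _ gen, of k] not_UNIV word_span_mono[of 0 0 k 4 S] that by auto
  have *: "matrix.dim (word_span 0 S (k - 1)) + 2 \<le> matrix.dim (word_span 0 S k)"
    if "2 \<le> k" "k \<le> 4" for k
    using that neq[of k] by (intro dim_word_span_growth) auto
  obtain A B where AB: "A \<in> S" "B \<in> S" "A ** B \<noteq> B ** A"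
    using generating_set_not_commuting[OF gen] by blast
  \<comment> \<open>From dimension at least 3 at length 1, growth by two at lengths 2, 3 and 4
    yields 9.\<close>
  have "3 = matrix.dim {B, A, mat 1}"
    using not_commuting_independent[OF AB(3)] by (simp add: matrix.dim_insert)
  also have "\<dots> \<le> matrix.dim (word_span 0 S 1)"
    using AB word_prod_in_word_span[of "[]" S 0 1] word_prod_in_word_span[of "[A]" S 0 1]
      word_prod_in_word_span[of "[B]" S 0 1]
    by (intro matrix.dim_subset) auto
  finally have "9 \<le> matrix.dim (word_span 0 S 4)"
    using *[of 2] *[of 3] *[of 4] by simp
  then have "matrix.dim (UNIV :: ('a^3^3) set) \<le> matrix.dim (word_span 0 S 4)"
    by (simp only: dim_matrix_UNIV) simp
  then show False
    using not_UNIV matrix.subspace_dim_equal[OF subspace_word_span matrix.subspace_UNIV subset_UNIV]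
    by blast
qed

text \<open>\<open>J\<close> is a left ideal of codimension at most one. An off-diagonal unit
  \<open>N\<close> has \<open>N ** N = 0\<close> and is congruent to a scalar \<open>c\<close>
  modulo \<open>J\<close>; multiplying by \<open>N\<close> puts \<open>c N\<close> in
  \<open>J\<close>, so \<open>N\<close> is in \<open>J\<close> whether or not \<open>c\<close>
  vanishes.\<close>

lemma left_ideal_eq_UNIV:
  fixes J :: "('a::field^3^3) set"
  assumes J: "matrix.subspace J" "\<And>M N. N \<in> J \<Longrightarrow> M ** N \<in> J"
    and one: "matrix.span (insert (mat 1) J) = UNIV"
  shows "J = UNIV"
proof -
  have unit: "matrix_unit i j \<in> J" if "i \<noteq> j" for i j
  proof -
    define N :: "'a^3^3" where "N = matrix_unit i j"
    have NN: "N ** N = 0"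
      using that by (simp add: N_def matrix_unit_mult)
    have "N \<in> matrix.span (insert (mat 1) J)"
      by (simp add: one)
    moreover have "matrix.span J = J"
      using J(1) by (simp add: matrix.span_eq_iff)
    ultimately obtain c where c: "N - msmult c (mat 1) \<in> J"
      by (auto simp: matrix.span_breakdown_eq)
    then have "N ** (N - msmult c (mat 1)) \<in> J"
      by (rule J(2))
    then have "- msmult c N \<in> J"
      by (simp add: matrix_sub_ldistrib msmult_mult NN)
    then have *: "msmult (- inverse c) (- msmult c N) \<in> J"
      using J(1) matrix.subspace_scale by blast
    show "N \<in> J"
    proof (cases "c = 0")
      case True
      then show ?thesis using c by simp
    next
      case False
      then show ?thesis using * by simp
    qed
  qed
  \<comment> \<open>Each diagonal unit is a product of two off-diagonal ones, so the identity lies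
    in \<open>J\<close>.\<close>
  have "matrix_unit 1 (2::3) ** matrix_unit 2 1 + matrix_unit 2 (3::3) ** matrix_unit 3 2
      + matrix_unit 3 (1::3) ** matrix_unit 1 3 \<in> J"
    by (intro matrix.subspace_add J unit) auto
  also have "matrix_unit 1 (2::3) ** matrix_unit 2 1 + matrix_unit 2 (3::3) ** matrix_unit 3 2
      + matrix_unit 3 (1::3) ** matrix_unit 1 3 = (mat 1 :: 'a^3^3)"
    by (simp add: matrix_unit_mult vec_eq_iff forall_3 matrix_unit_nth mat_def)
  finally have "X ** mat 1 \<in> J" for X
    by (rule J(2))
  then show ?thesis
    by auto
qed

lemma word_span_1_stable:
  fixes S :: "('a::field^3^3) set"
  assumes gen: "generating_set S" and eq: "word_span 1 S 5 = word_span 1 S 4"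
  shows "word_span 1 S 4 = UNIV"
proof (rule left_ideal_eq_UNIV)
  show "M ** N \<in> word_span 1 S 4" if "N \<in> word_span 1 S 4" for M N
    using word_span_Suc_eq_left_ideal[of 1 S 4 M N] that eq gen by (simp add: generating_set_def)
  show "matrix.span (insert (mat 1) (word_span 1 S 4)) = UNIV"
    using word_span_0_4_eq_UNIV[OF gen] word_span_0_eq by metis
qed (rule subspace_word_span)

section \<open>Invariant subspaces and irreducibility of a pair\<close>

lemma gen_alg_invariant:
  assumes "X \<in> gen_alg S" "vec.subspace T" "\<And>A x. A \<in> S \<Longrightarrow> x \<in> T \<Longrightarrow> A *v x \<in> T" "x \<in> T"
  shows "X *v x \<in> T"
  using assms(1,4)
proof (induction arbitrary: x rule: gen_alg.induct)
  case (base A)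
  then show ?case using assms(3) by simp
next
  case zero
  then show ?case using assms(2) by (simp add: vec.subspace_0)
next
  case (add A B)
  then show ?case using assms(2) by (simp add: matrix_vector_mult_add_rdistrib vec.subspace_add)
next
  case (smult A c)
  then show ?case using assms(2) by (simp add: msmult_mult_vec vec.subspace_scale)
next
  case (mult A B)
  then show ?case by (simp flip: matrix_vector_mul_assoc)
qed simp

definition irreducible_pair :: "'a::field^'n^'n \<Rightarrow> 'a^'n^'n \<Rightarrow> bool" where
  "irreducible_pair A B \<longleftrightarrow> (\<forall>T. vec.subspace T \<longrightarrow>
     (\<forall>x\<in>T. A *v x \<in> T \<and> B *v x \<in> T) \<longrightarrow> T = {0} \<or> T = UNIV)"

text \<open>A subspace invariant under \<open>A\<close> and \<open>B\<close> is invariant under all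
  matrices, and these carry any nonzero vector to any vector.\<close>

lemma generating_set_irreducible_pair:
  fixes S :: "('a::field^'n^'n) set"
  assumes gen: "generating_set S" and S: "S \<subseteq> matrix.span {A, B}"
  shows "irreducible_pair A B"
  unfolding irreducible_pair_def
proof (intro allI impI)
  fix T :: "('a^'n) set"
  assume T: "vec.subspace T" "\<forall>x\<in>T. A *v x \<in> T \<and> B *v x \<in> T"
  have inv: "M *v x \<in> T" if "x \<in> T" for M x
  proof (rule gen_alg_invariant)
    show "M \<in> gen_alg S"
      using gen by (simp add: generating_set_def)
    fix C y assume "C \<in> S" "y \<in> T"
    then have "C \<in> matrix.span {A, B}"
      using S by blast
    then obtain c d where "C - msmult c A - msmult d B = 0"
      by (auto simp: matrix.span_breakdown_eq)
    then have "C = msmult c A + msmult d B"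
      by (simp add: algebra_simps)
    then show "C *v y \<in> T"
      using T \<open>y \<in> T\<close>
      by (simp add: matrix_vector_mult_add_rdistrib msmult_mult_vec vec.subspace_add vec.subspace_scale)
  qed (use T that in auto)
  show "T = {0} \<or> T = UNIV"
  proof (rule disjCI)
    assume "T \<noteq> UNIV"
    have "x = 0" if "x \<in> T" for x
    proof (rule ccontr)
      assume "x \<noteq> 0"
      then obtain i where i: "x $ i \<noteq> 0"
        by (auto simp: vec_eq_iff)
      have "y \<in> T" for y
      proof -
        \<comment> \<open>Only column \<open>i\<close> is nonzero; it is \<open>y\<close> divided by
          \<open>x $ i\<close>, so \<open>x\<close> is sent to \<open>y\<close>.\<close>
        define M :: "'a^'n^'n" where "M = (\<chi> k l. if l = i then y $ k / x $ i else 0)"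
        have "(\<Sum>l\<in>UNIV. (if l = i then y $ k / x $ i else 0) * x $ l) = y $ k" for k
          using i by (simp add: if_distrib[of "\<lambda>c. c * _"] cong: if_cong)
        then have "M *v x = y"
          by (simp add: M_def vec_eq_iff matrix_vector_mult_def)
        then show ?thesis
          using inv[OF that, of M] by simp
      qed
      with \<open>T \<noteq> UNIV\<close> show False
        by auto
    qed
    then show "T = {0}"
      using T(1) vec.subspace_0 by blast
  qed
qed

text \<open>Reduces the test of invariance to spanning vectors, the form in which irreducibility is
  applied below.\<close>

lemma irreducible_pair_span:
  assumes irr: "irreducible_pair A B"
    and "\<And>x. x \<in> X \<Longrightarrow> A *v x \<in> vec.span X \<and> B *v x \<in> vec.span X"
  shows "X \<subseteq> {0} \<or> vec.span X = UNIV"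
proof -
  have "A *v x \<in> vec.span X \<and> B *v x \<in> vec.span X" if "x \<in> vec.span X" for x
    using that
  proof (induction rule: vec.span_induct_alt)
    case base
    then show ?case by (simp add: vec.span_zero)
  next
    case (step c x y)
    then show ?case
      using assms(2)[of x]
      by (simp add: matrix_vector_right_distrib vector_scalar_commute vec.span_add vec.span_scale)
  qed
  then have "vec.span X = {0} \<or> vec.span X = UNIV"
    using irr unfolding irreducible_pair_def by simp
  then show ?thesis
    using vec.span_superset by blast
qed

section \<open>Linear algebra and null vectors of pencils in dimension three\<close>

lemma vec_dim_eq_3_iff: "vec.dim X = 3 \<longleftrightarrow> vec.span X = UNIV" for X :: "('a::field^3) set"
  using vec.dim_eq_full[of X] by (simp add: vec.dimension_def card_cart_basis)

lemma span_2_neq_UNIV: "vec.span {x, y} \<noteq> UNIV" for x y :: "'a::field^3"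
proof -
  have "vec.dim {x, y} \<noteq> 3"
    by (simp add: vec.dim_insert)
  then show ?thesis
    by (simp add: vec_dim_eq_3_iff)
qed

text \<open>The span of a common null vector is invariant and too small to be the whole
  space.\<close>

lemma irreducible_pair_common_kernel:
  fixes A B :: "'a::field^3^3"
  assumes "irreducible_pair A B" "A *v x = 0" "B *v x = 0"
  shows "x = 0"
  using irreducible_pair_span[OF assms(1), of "{x}"] assms(2,3) span_2_neq_UNIV[of x x]
  by (auto simp: vec.span_zero)

lemma span_3_eq_UNIV_independent:
  fixes x y z :: "'a::field^3"
  assumes span: "vec.span {x, y, z} = UNIV" and eq: "a *s x + b *s y + c *s z = 0"
  shows "a = 0 \<and> b = 0 \<and> c = 0"
proof -
  \<comment> \<open>It suffices to treat the leading coefficient; the other two follow by permuting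
    the vectors.\<close>
  have *: "d = 0" if "vec.span {u, v, w} = UNIV" "d *s u + e *s v + f *s w = 0"
    for d e f and u v w :: "'a^3"
  proof (rule ccontr)
    assume "d \<noteq> 0"
    have "u = (- inverse d) *s (e *s v + f *s w)"
    proof -
      have "d *s u = - (e *s v + f *s w)"
        using that(2) by (simp only: add.assoc eq_neg_iff_add_eq_0)
      then have "inverse d *s (d *s u) = - (inverse d *s (e *s v + f *s w))"
        by (simp only: vec.scale_minus_right)
      then show ?thesis
        using \<open>d \<noteq> 0\<close> by simp
    qed
    also have "\<dots> \<in> vec.span {v, w}"
      by (intro vec.span_scale vec.span_add) (auto intro: vec.span_base)
    finally have "vec.span {u, v, w} = vec.span {v, w}"
      by (rule vec.span_redundant)
    with that(1) span_2_neq_UNIV[of v w] show False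
      by simp
  qed
  show ?thesis
    using *[of x y z a b c] *[of y x z b a c] *[of z x y c a b] span eq
    by (simp add: insert_commute add_ac)
qed

lemma span_3_cases:
  fixes x y z :: "'a::field^3"
  obtains "vec.span {x, y, z} = UNIV"
  | a b c where "a *s x + b *s y + c *s z = 0" "a \<noteq> 0 \<or> b \<noteq> 0 \<or> c \<noteq> 0"
proof (cases "z = 0 \<or> y \<in> vec.span {z} \<or> x \<in> vec.span {y, z}")
  case True
  then consider "z = 0" | b where "y = b *s z" | b c where "x - b *s y - c *s z = 0"
    by (auto simp: vec.span_breakdown_eq)
  then show ?thesis
  proof cases
    case 1
    then show ?thesis using that(2)[of 0 0 1] by simp
  next
    case (2 b)
    then show ?thesis using that(2)[of 0 1 "- b"] by simp
  next
    case (3 b c)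
    then show ?thesis using that(2)[of 1 "- b" "- c"] by simp
  qed
next
  case False
  then have "vec.dim {x, y, z} = 3"
    by (simp add: vec.dim_insert)
  then show ?thesis
    using that(1) by (simp add: vec_dim_eq_3_iff)
qed

text \<open>A quadratic polynomial null vector \<open>x\<^sup>2 p + x y n + y\<^sup>2 q\<close> of the pencil \<open>x A + y B\<close> can be
  replaced by a linear one \<open>x p' + y m'\<close>, since otherwise \<open>p\<close>, \<open>n\<close>, \<open>q\<close> form a basis and the
  images of \<open>A\<close> and \<open>B\<close> lie in a common plane.\<close>

lemma linear_null_vector_of_pencil:
  fixes A B :: "'a::field^3^3"
  assumes irr: "irreducible_pair A B" and nz: "p \<noteq> 0 \<or> n \<noteq> 0 \<or> q \<noteq> 0"
    and Ap: "A *v p = 0" and An: "A *v n + B *v p = 0" and Bn: "B *v n + A *v q = 0"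
    and Bq: "B *v q = 0"
  obtains p' m' where "p' \<noteq> 0 \<or> m' \<noteq> 0" "A *v p' = 0" "B *v m' = 0" "A *v m' + B *v p' = 0"
proof -
  have An': "A *v n = - (B *v p)" and Aq': "A *v q = - (B *v n)"
    using An Bn by (simp_all add: eq_neg_iff_add_eq_0 add.commute)
  show ?thesis
  proof (cases rule: span_3_cases[of p n q])
    case 1
    define T where "T = {B *v p, B *v n}"
    have img: "A *v x \<in> vec.span T \<and> B *v x \<in> vec.span T" for x
    proof -
      have "x \<in> vec.span {p, n, q}"
        using 1 by simp
      then show ?thesis
      proof (induction rule: vec.span_induct_alt)
        case base
        then show ?case by (simp add: vec.span_zero)
      next
        case (step c x y)
        have "A *v x \<in> vec.span T \<and> B *v x \<in> vec.span T"
          using step(1) Ap An' Aq' Bq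
          by (auto simp: T_def vec.span_zero intro!: vec.span_neg intro: vec.span_base)
        then show ?case
          using step
          by (simp add: matrix_vector_right_distrib vector_scalar_commute vec.span_add vec.span_scale)
      qed
    qed
    \<comment> \<open>The span of \<open>T\<close> contains all images, so it is invariant, and two
      vectors cannot span the space. Hence both vanish, and \<open>p\<close>, \<open>n\<close>,
      \<open>q\<close> are killed by \<open>A\<close> and \<open>B\<close>.\<close>
    have "T \<subseteq> {0}"
      using irreducible_pair_span[OF irr, of T] img span_2_neq_UNIV[of "B *v p" "B *v n"]
      by (auto simp: T_def)
    then have "B *v p = 0" "B *v n = 0"
      by (auto simp: T_def)
    then have "p = 0" "n = 0" "q = 0"
      using irreducible_pair_common_kernel[OF irr] Ap An' Aq' Bq by simp_all
    with nz show ?thesis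
      by simp
  next
    case (2 a b c)
    \<comment> \<open>\<open>C\<close> and \<open>D\<close> stand for \<open>A\<close> and
      \<open>B\<close> in either order. From \<open>r = d u + e v\<close> follows
      \<open>D v = e D u\<close>, so \<open>x u + y (v - e u)\<close> is a null vector of
      \<open>x C + y D\<close>.\<close>
    have quad: thesis
      if "r = d *s u + e *s v" "C *v u = 0" "C *v v = - (D *v u)" "C *v r = - (D *v v)" "u \<noteq> 0 \<or> v \<noteq> 0"
        and *: "\<And>u v. u \<noteq> 0 \<or> v \<noteq> 0 \<Longrightarrow> C *v u = 0 \<Longrightarrow> D *v v = 0 \<Longrightarrow> C *v v + D *v u = 0 \<Longrightarrow> thesis"
      for r u v d e and C D :: "'a^3^3"
    proof (rule *)
      show "C *v u = 0"
        by fact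
      show "u \<noteq> 0 \<or> v - e *s u \<noteq> 0"
        using that(5) by auto
      have "- (D *v v) = - (e *s (D *v u))"
        using that(1-4) by (simp add: matrix_vector_right_distrib vector_scalar_commute)
      then show "D *v (v - e *s u) = 0"
        by (simp add: matrix_vector_mult_diff_distrib vector_scalar_commute)
      show "C *v (v - e *s u) + D *v u = 0"
        using that(2,3) by (simp add: matrix_vector_mult_diff_distrib vector_scalar_commute)
    qed
    consider "c \<noteq> 0" | "a \<noteq> 0" | "b \<noteq> 0" "a = 0" "c = 0"
      using 2 by blast
    then show ?thesis
    proof cases
      case 1
      have "c *s q = - (a *s p + b *s n)"
        using 2(1) by (simp only: eq_neg_iff_add_eq_0 add.commute)
      then have "inverse c *s (c *s q) = inverse c *s (- (a *s p + b *s n))"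
        by simp
      then have q: "q = (- inverse c * a) *s p + (- inverse c * b) *s n"
        using 1 by (simp add: vec.scale_right_distrib vec.scale_right_diff_distrib)
      show ?thesis
      proof (rule quad[OF q Ap An' Aq'])
        show "p \<noteq> 0 \<or> n \<noteq> 0"
          using q nz by auto
      qed (use that in blast)
    next
      case 2
      have "a *s p = - (c *s q + b *s n)"
        using \<open>a *s p + b *s n + c *s q = 0\<close> by (simp only: eq_neg_iff_add_eq_0 add_ac)
      then have "inverse a *s (a *s p) = inverse a *s (- (c *s q + b *s n))"
        by simp
      then have p: "p = (- inverse a * c) *s q + (- inverse a * b) *s n"
        using 2 by (simp add: vec.scale_right_distrib vec.scale_right_diff_distrib)
      \<comment> \<open>Mirror image of the previous case: \<open>A\<close> is exchanged with
        \<open>B\<close> and \<open>p\<close> with \<open>q\<close>, which reverses the resulting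
        pair.\<close>
      have "B *v n = - (A *v q)" "B *v p = - (A *v n)"
        using An' Aq' by simp_all
      show ?thesis
      proof (rule quad[OF p Bq \<open>B *v n = - (A *v q)\<close> \<open>B *v p = - (A *v n)\<close>])
        show "q \<noteq> 0 \<or> n \<noteq> 0"
          using p nz by auto
        show thesis if "u \<noteq> 0 \<or> v \<noteq> 0" "B *v u = 0" "A *v v = 0" "B *v v + A *v u = 0" for u v
          using that \<open>\<And>p' m'. p' \<noteq> 0 \<or> m' \<noteq> 0 \<Longrightarrow> A *v p' = 0 \<Longrightarrow> B *v m' = 0 \<Longrightarrow> A *v m' + B *v p' = 0 \<Longrightarrow> thesis\<close>[of v u]
          by (auto simp: add.commute)
      qed
    next
      case 3
      \<comment> \<open>Now \<open>p\<close> and \<open>q\<close> are themselves killed by both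
        matrices, and one of them is nonzero.\<close>
      then have "n = 0"
        using 2 by simp
      then show ?thesis
        using that[of p 0] that[of 0 q] nz Ap An' Aq' Bq by auto
    qed
  qed
qed

text \<open>With \<open>e = B p = - A m\<close>, both \<open>p, m, e\<close> and
  \<open>e, A e, B e\<close> are bases. Evaluating a linear relation at \<open>m\<close> and at
  \<open>p\<close> gives relations among \<open>e\<close>, \<open>A e\<close>, \<open>B e\<close>
  that involve all five coefficients.\<close>

lemma dim_products_eq_5:
  fixes A B :: "'a::field^3^3"
  assumes irr: "irreducible_pair A B"
    and pm: "p \<noteq> 0 \<or> m \<noteq> 0" "A *v p = 0" "B *v m = 0" "A *v m + B *v p = 0"
  shows "matrix.dim {B ** A, A ** B, A ** A, B, A} = 5"
proof -
  define e where "e = B *v p"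
  have Am: "A *v m = - e" and Bp: "B *v p = e"
    using pm by (simp_all add: e_def eq_neg_iff_add_eq_0)
  have e: "e \<noteq> 0"
    using irreducible_pair_common_kernel[OF irr, of p] irreducible_pair_common_kernel[OF irr, of m] pm Am
    by (auto simp: e_def)
  have m: "m \<notin> vec.span {p}"
  proof
    assume "m \<in> vec.span {p}"
    then obtain c where "m = c *s p"
      by (auto simp: vec.span_breakdown_eq)
    then show False
      using pm(2) Am e by (simp add: vector_scalar_commute)
  qed
  \<comment> \<open>Otherwise the plane of \<open>m\<close> and \<open>p\<close> would be invariant,
    since \<open>A\<close> and \<open>B\<close> map it to multiples of \<open>e\<close>.\<close>
  have "e \<notin> vec.span {m, p}"
  proof
    assume e_span: "e \<in> vec.span {m, p}"
    have "{m, p} \<subseteq> {0} \<or> vec.span {m, p} = UNIV"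
      using e_span Am Bp pm
      by (intro irreducible_pair_span[OF irr]) (auto simp: vec.span_zero vec.span_neg)
    then show False
      using span_2_neq_UNIV pm(1) by blast
  qed
  then have "vec.dim {e, m, p} = 3"
    using m e Bp by (auto simp: vec.dim_insert)
  then have basis: "vec.span {e, m, p} = UNIV"
    by (simp add: vec_dim_eq_3_iff)
  define T where "T = {e, A *v e, B *v e}"
  have img: "A *v x \<in> vec.span T \<and> B *v x \<in> vec.span T" for x
  proof -
    have "x \<in> vec.span {e, m, p}"
      using basis by simp
    then show ?thesis
    proof (induction rule: vec.span_induct_alt)
      case base
      then show ?case by (simp add: vec.span_zero)
    next
      case (step c x y)
      have "A *v x \<in> vec.span T \<and> B *v x \<in> vec.span T"
        using step(1) Am Bp pm
        by (auto simp: T_def vec.span_zero intro!: vec.span_neg intro: vec.span_base)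
      then show ?case
        using step
        by (simp add: matrix_vector_right_distrib vector_scalar_commute vec.span_add vec.span_scale)
    qed
  qed
  \<comment> \<open>The span of \<open>T\<close> contains all images, so it is invariant, and it
    contains the nonzero vector \<open>e\<close>.\<close>
  have T: "vec.span {e, A *v e, B *v e} = UNIV"
    using irreducible_pair_span[OF irr, of T] img e by (auto simp: T_def)
  have indep: "a = 0 \<and> b = 0 \<and> c = 0 \<and> d = 0 \<and> f = 0"
    if eq: "msmult a A + msmult b B + msmult c (A ** A) + msmult d (A ** B) + msmult f (B ** A) = 0"
    for a b c d f
  proof -
    \<comment> \<open>At \<open>m\<close> the terms with \<open>b\<close> and \<open>d\<close>
      vanish since \<open>B m = 0\<close>; below, at \<open>p\<close>, those with \<open>a\<close>,
      \<open>c\<close> and \<open>f\<close> vanish since \<open>A p = 0\<close>.\<close>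
    have "(msmult a A + msmult b B + msmult c (A ** A) + msmult d (A ** B) + msmult f (B ** A)) *v m =
        (- a) *s e + (- c) *s (A *v e) + (- f) *s (B *v e)"
      using Am pm vec.neg[of A e] vec.neg[of B e]
      by (simp add: matrix_vector_mult_add_rdistrib msmult_mult_vec flip: matrix_vector_mul_assoc)
    then have "a = 0 \<and> c = 0 \<and> f = 0"
      using span_3_eq_UNIV_independent[OF T, of "- a" "- c" "- f"] eq by simp
    moreover have "(msmult a A + msmult b B + msmult c (A ** A) + msmult d (A ** B) + msmult f (B ** A)) *v p =
        b *s e + d *s (A *v e) + 0 *s (B *v e)"
      using Bp pm
      by (simp add: matrix_vector_mult_add_rdistrib msmult_mult_vec flip: matrix_vector_mul_assoc)
    then have "b = 0 \<and> d = 0"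
      using span_3_eq_UNIV_independent[OF T, of b d 0] eq by simp
    ultimately show ?thesis
      by simp
  qed
  note span_iff = matrix.span_breakdown_eq matrix.span_empty singleton_iff
  have "A \<noteq> 0"
    using indep[of 1 0 0 0 0] by auto
  moreover have "B \<notin> matrix.span {A}"
  proof
    assume "B \<in> matrix.span {A}"
    then obtain a where "B - msmult a A = 0"
      unfolding span_iff by blast
    then show False
      using indep[of "- a" 1 0 0 0] by simp
  qed
  moreover have "A ** A \<notin> matrix.span {B, A}"
  proof
    assume "A ** A \<in> matrix.span {B, A}"
    then obtain a b where "A ** A - msmult b B - msmult a A = 0"
      unfolding span_iff by blast
    then show False
      using indep[of "- a" "- b" 1 0 0] by (simp add: algebra_simps)
  qed
  moreover have "A ** B \<notin> matrix.span {A ** A, B, A}"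
  proof
    assume "A ** B \<in> matrix.span {A ** A, B, A}"
    then obtain a b c where "A ** B - msmult c (A ** A) - msmult b B - msmult a A = 0"
      unfolding span_iff by blast
    then show False
      using indep[of "- a" "- b" "- c" 1 0] by (simp add: algebra_simps)
  qed
  moreover have "B ** A \<notin> matrix.span {A ** B, A ** A, B, A}"
  proof
    assume "B ** A \<in> matrix.span {A ** B, A ** A, B, A}"
    then obtain a b c d
      where "B ** A - msmult d (A ** B) - msmult c (A ** A) - msmult b B - msmult a A = 0"
      unfolding span_iff by blast
    then show False
      using indep[of "- a" "- b" "- c" "- d" 1] by (simp add: algebra_simps)
  qed
  ultimately show ?thesis
    by (simp add: matrix.dim_insert)
qed

subsection \<open>Words of length at most four\<close>

text \<open>Turns the Cayley-Hamilton identities, where a combination of words equals a scalar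
  matrix, into the vanishing of that combination.\<close>

lemma scalar_in_word_span_1_eq_0:
  assumes "M \<in> word_span 1 S k" "mat 1 \<notin> word_span 1 S k" "M = msmult c (mat 1)"
  shows "M = 0"
proof (rule ccontr)
  assume "M \<noteq> 0"
  then have "c \<noteq> 0"
    using assms(3) by auto
  then have "mat 1 = msmult (inverse c) M"
    by (simp add: assms(3))
  also have "\<dots> \<in> word_span 1 S k"
    using assms(1) by (rule matrix.subspace_scale[OF subspace_word_span])
  finally show False
    using assms(2) by simp
qed

theorem word_span_1_4_eq_UNIV:
  fixes S :: "('a::field^3^3) set"
  assumes gen: "generating_set S"
  shows "word_span 1 S 4 = UNIV"
proof (rule ccontr)
  assume not_UNIV: "word_span 1 S 4 \<noteq> UNIV"
  \<comment> \<open>Stability at any length up to 4 would propagate to lengths 4 and 5, where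
    \<open>word_span_1_stable\<close> applies.\<close>
  have neq: "word_span 1 S (Suc k) \<noteq> word_span 1 S k" if "k \<le> 4" for k
  proof
    assume stable: "word_span 1 S (Suc k) = word_span 1 S k"
    have *: "word_span 1 S l = word_span 1 S k" if "k \<le> l" for l
      using that by (intro word_span_stable[OF _ stable]) simp_all
    have "word_span 1 S 5 = word_span 1 S 4"
      using *[of 4] *[of 5] that by (simp del: One_nat_def)
    then show False
      using word_span_1_stable[OF gen] not_UNIV by blast
  qed
  \<comment> \<open>Adjoining the identity gives the full algebra, so it cannot already be
    present.\<close>
  have one4: "mat 1 \<notin> word_span 1 S 4"
    using word_span_0_4_eq_UNIV[OF gen] word_span_0_eq[of S 4] not_UNIV
    by (auto simp: insert_absorb)
  have one: "mat 1 \<notin> word_span 1 S k" if "k \<le> 4" for k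
    using one4 word_span_mono[of 1 1 k 4 S] that by auto
  have dim0: "matrix.dim (word_span 0 S k) = matrix.dim (word_span 1 S k) + 1" if "k \<le> 4" for k
    using one[OF that] by (simp add: word_span_0_eq matrix.dim_insert del: One_nat_def)
  have dim9: "matrix.dim (UNIV :: ('a^3^3) set) = 9"
    by (simp only: dim_matrix_UNIV) simp
  have "matrix.dim (word_span 1 S 4) < 9"
    using matrix.subspace_dim_equal[OF subspace_word_span matrix.subspace_UNIV subset_UNIV, of 1 S 4]
      not_UNIV dim9 by fastforce
  \<comment> \<open>The dimension is at most 8 at length 4, and each of the last two steps adds at
    least 2. For \<open>a = 1\<close> the growth bound starts only at length 3.\<close>
  then have dim2: "matrix.dim (word_span 1 S 2) \<le> 4"
    using dim_word_span_growth[of 1 3 S] dim_word_span_growth[of 1 4 S] neq[of 3] neq[of 4]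
    by simp
  \<comment> \<open>For the step from length 1 to 2 the spans with identity take over, where the
    growth bound holds from length 2 on. Equality here would force dimension 9, but it is at most
    5.\<close>
  have "word_span 0 S (Suc 2) \<noteq> word_span 0 S 2"
    using word_span_0_stable[OF _ gen, of 2] dim0[of 2] dim2 dim9 by auto
  then have dim01: "matrix.dim (word_span 0 S 1) + 2 \<le> matrix.dim (word_span 0 S 2)"
    using dim_word_span_growth[of 0 2 S] by simp
  then have dim1: "matrix.dim (word_span 1 S 1) \<le> 2"
    using dim0[of 1] dim0[of 2] dim2 by simp

  obtain A B where AB: "A \<in> S" "B \<in> S" "A ** B \<noteq> B ** A"
    using generating_set_not_commuting[OF gen] by blast
  have dimAB: "matrix.dim {A, B} = 2"
    using not_commuting_independent[OF AB(3)] by (simp add: matrix.dim_insert insert_commute[of A B])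
  have AB_in: "{A, B} \<subseteq> word_span 1 S 1"
    using AB word_prod_in_word_span[of "[A]" S 1 1] word_prod_in_word_span[of "[B]" S 1 1] by simp
  have span: "matrix.span {A, B} = word_span 1 S 1"
    using AB_in dimAB dim1
    by (intro matrix.subspace_dim_equal matrix.span_minimal subspace_word_span matrix.subspace_span)
      simp_all
  have S: "S \<subseteq> matrix.span {A, B}"
    unfolding span using word_prod_in_word_span[of "[_]" S 1 1] by auto
  have irr: "irreducible_pair A B"
    using gen S by (rule generating_set_irreducible_pair)

  have w1: "X \<in> word_span 1 S k" if "X \<in> S" "1 \<le> k" for X k
    using word_prod_in_word_span[of "[X]" S 1 k] that by simp
  have w2: "X ** Y \<in> word_span 1 S k" if "X \<in> S" "Y \<in> S" "2 \<le> k" for X Y k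
    using word_prod_in_word_span[of "[X, Y]" S 1 k] that by simp
  have w3: "X ** (Y ** Z) \<in> word_span 1 S 3" if "X \<in> S" "Y \<in> S" "Z \<in> S" for X Y Z
    using word_prod_in_word_span[of "[X, Y, Z]" S 1 3] that by simp
  note mem = matrix.subspace_add matrix.subspace_diff matrix.subspace_scale subspace_word_span w1 w2 w3

  have one3: "mat 1 \<notin> word_span 1 S 3"
    by (rule one) simp
  \<comment> \<open>Without constant term, \<open>X ** adj_3 X\<close> lies in the span of words of
    length at most 3; being scalar, it vanishes, so \<open>X\<close> is singular.\<close>
  have adj: "X ** adj_3 X = 0" if "X \<in> S" for X
  proof -
    have "X ** adj_3 X \<in> word_span 1 S 3"
      unfolding adj_3_def matrix_add_ldistrib matrix_sub_ldistrib msmult_mult matrix_mul_rid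
      using that by (intro mem) auto
    moreover obtain c where "X ** adj_3 X = msmult c (mat 1)"
      using mult_adj_3 by blast
    ultimately show ?thesis
      by (rule scalar_in_word_span_1_eq_0[OF _ one3])
  qed
  have mixed: "X ** mixed_adj_3 X Y + Y ** adj_3 X = 0" if "X \<in> S" "Y \<in> S" for X Y
  proof -
    have "X ** mixed_adj_3 X Y + Y ** adj_3 X \<in> word_span 1 S 3"
      unfolding adj_3_def mixed_adj_3_def matrix_add_ldistrib matrix_sub_ldistrib msmult_mult matrix_mul_rid
      using that by (intro mem) auto
    moreover obtain c where "X ** mixed_adj_3 X Y + Y ** adj_3 X = msmult c (mat 1)"
      using mult_mixed_adj_3 by blast
    ultimately show ?thesis
      by (rule scalar_in_word_span_1_eq_0[OF _ one3])
  qed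

  \<comment> \<open>Otherwise \<open>A ** A\<close>, \<open>B ** B\<close> and \<open>B ** A\<close>
    reduce to \<open>mat 1\<close>, \<open>A\<close>, \<open>B\<close>, \<open>A ** B\<close>, so
    \<open>word_span 0 S 2\<close> has dimension at most 4. By \<open>dim01\<close> it has at least
    3 + 2.\<close>
  have "adj_3 A \<noteq> 0 \<or> mixed_adj_3 A B \<noteq> 0 \<or> adj_3 B \<noteq> 0"
  proof (rule ccontr)
    assume "\<not> ?thesis"
    then have zero: "adj_3 A = 0" "mixed_adj_3 A B = 0" "adj_3 B = 0"
      by auto
    define Y where "Y = matrix.span {mat 1, A, B, A ** B}"
    have Y: "mat 1 \<in> Y" "A \<in> Y" "B \<in> Y" "A ** B \<in> Y" "matrix.subspace Y"
      by (auto simp: Y_def intro: matrix.span_base)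
    note Y_mem = matrix.subspace_add matrix.subspace_diff matrix.subspace_scale Y
    have "A ** A = msmult (trace_3 A) A - msmult (minors_3 A) (mat 1)"
      "B ** B = msmult (trace_3 B) B - msmult (minors_3 B) (mat 1)"
      "B ** A = msmult (trace_3 A) B + msmult (trace_3 B) A
        - msmult (minors_3 (A + B) - minors_3 A - minors_3 B) (mat 1) - A ** B"
      using zero by (simp_all add: adj_3_def mixed_adj_3_def algebra_simps)
    moreover have "msmult (trace_3 A) A - msmult (minors_3 A) (mat 1) \<in> Y"
      "msmult (trace_3 B) B - msmult (minors_3 B) (mat 1) \<in> Y"
      "msmult (trace_3 A) B + msmult (trace_3 B) A
        - msmult (minors_3 (A + B) - minors_3 A - minors_3 B) (mat 1) - A ** B \<in> Y"
      by (intro Y_mem)+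
    ultimately have products: "M ** N \<in> Y" if "M \<in> {A, B}" "N \<in> {A, B}" for M N
      using that Y by auto
    have "word_span 0 S 2 \<subseteq> Y"
    proof (rule word_span_leI)
      fix ws assume ws: "set ws \<subseteq> S" "length ws \<le> 2"
      then consider "ws = []" | s where "ws = [s]" "s \<in> S" | s t where "ws = [s, t]" "s \<in> S" "t \<in> S"
        by (cases ws; cases "tl ws") auto
      then show "word_prod ws \<in> Y"
      proof cases
        case 1
        then show ?thesis using Y by simp
      next
        case (2 s)
        moreover have "matrix.span {A, B} \<subseteq> Y"
          using Y by (intro matrix.span_minimal) auto
        ultimately show ?thesis using S by auto
      next
        case (3 s t)
        have "s ** t \<in> Y"
        proof (rule span_mult_right_mem)
          show "s \<in> matrix.span {A, B}"
            using 3 S by blast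
          show "N ** t \<in> Y" if "N \<in> {A, B}" for N
          proof (rule span_mult_left_mem)
            show "t \<in> matrix.span {A, B}"
              using 3 S by blast
          qed (use products that Y in blast)+
        qed (rule Y)
        then show ?thesis using 3 by simp
      qed
    qed (rule Y)
    then have "matrix.dim (word_span 0 S 2) \<le> matrix.dim Y"
      by (rule matrix.dim_subset)
    also have "\<dots> \<le> 4"
      by (simp add: Y_def matrix.dim_insert)
    finally show False
      using dim01 dim0[of 1] matrix.dim_subset[OF AB_in] dimAB by simp
  qed
  then obtain x where x: "adj_3 A *v x \<noteq> 0 \<or> mixed_adj_3 A B *v x \<noteq> 0 \<or> adj_3 B *v x \<noteq> 0"
    unfolding matrix_eq by auto
  \<comment> \<open>The coefficients of the pencil times its adjugate, applied to the vector
    \<open>x\<close>; the third equation is \<open>mixed\<close> with \<open>A\<close> and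
    \<open>B\<close> exchanged.\<close>
  have "A *v (adj_3 A *v x) = 0" "A *v (mixed_adj_3 A B *v x) + B *v (adj_3 A *v x) = 0"
    "B *v (mixed_adj_3 A B *v x) + A *v (adj_3 B *v x) = 0" "B *v (adj_3 B *v x) = 0"
    using adj[OF AB(1)] mixed[OF AB(1,2)] adj[OF AB(2)] mixed[OF AB(2,1)]
    by (simp_all add: matrix_vector_mul_assoc mixed_adj_3_commute[of B A]
        flip: matrix_vector_mult_add_rdistrib)
  from linear_null_vector_of_pencil[OF irr x this] obtain p m
    where "p \<noteq> 0 \<or> m \<noteq> 0" "A *v p = 0" "B *v m = 0" "A *v m + B *v p = 0"
    by metis
  then have "5 = matrix.dim {B ** A, A ** B, A ** A, B, A}"
    using dim_products_eq_5[OF irr] by metis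
  also have "\<dots> \<le> matrix.dim (word_span 1 S 2)"
    using AB by (intro matrix.dim_subset) (auto simp: w1 w2 simp del: One_nat_def)
  finally show False
    using dim2 by simp
qed

lemma l0_le_4:
  fixes S :: "('a::field^3^3) set"
  assumes "generating_set S"
  shows "l0 S \<le> 4"
  unfolding l0_def
proof (rule Least_le)
  have "word_span 1 S 4 \<subseteq> word_span 1 S (Suc 4)"
    by (rule word_span_mono) auto
  then show "L0 S 4 = L0 S (Suc 4)"
    unfolding L0_eq_word_span word_span_1_4_eq_UNIV[OF assms] by blast
qed

lemma word_span_subset_gen_alg: "word_span a S k \<subseteq> gen_alg S"
proof (rule word_span_leI)
  show "matrix.subspace (gen_alg S)"
    by (rule matrix.subspaceI) (auto intro: gen_alg.intros)
  show "word_prod ws \<in> gen_alg S" if "set ws \<subseteq> S" for ws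
    using that by (induction ws) (auto intro: gen_alg.intros)
qed

subsection \<open>A pair attaining the bound\<close>

text \<open>\<open>A\<close> is the nilpotent shift and \<open>B\<close> closes the cycle. Words of
  length at most 4 span everything, but \<open>matrix_unit 1 2\<close> is not reached before
  \<open>A ** A ** B ** A\<close>.\<close>

lemma exists_l0_eq_4: "\<exists>S :: ('a::field^3^3) set. finite S \<and> generating_set S \<and> l0 S = 4"
proof -
  define A :: "'a^3^3" where "A = matrix_unit 1 2 + matrix_unit 2 3"
  define B :: "'a^3^3" where "B = matrix_unit 3 1"
  note mult = A_def B_def matrix_unit_mult matrix_add_ldistrib matrix_add_rdistrib
  have word: "word_prod ws \<in> word_span 1 {A, B} 4"
    if "set ws \<subseteq> {A, B}" "1 \<le> length ws" "length ws \<le> 4" for ws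
    using that by (rule word_prod_in_word_span)
  have units: "matrix_unit 1 1 \<in> word_span 1 {A, B} 4" "matrix_unit 1 2 \<in> word_span 1 {A, B} 4"
    "matrix_unit 1 3 \<in> word_span 1 {A, B} 4" "matrix_unit 2 1 \<in> word_span 1 {A, B} 4"
    "matrix_unit 2 2 \<in> word_span 1 {A, B} 4" "matrix_unit 3 1 \<in> word_span 1 {A, B} 4"
    "matrix_unit 3 2 \<in> word_span 1 {A, B} 4" "matrix_unit 3 3 \<in> word_span 1 {A, B} 4"
    "A \<in> word_span 1 {A, B} 4"
    using word[of "[A, A, B]"] word[of "[A, A, B, A]"] word[of "[A, A]"] word[of "[A, B]"]
      word[of "[A, B, A]"] word[of "[B]"] word[of "[B, A]"] word[of "[B, A, A]"] word[of "[A]"]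
    by (simp_all add: mult)
  have "A - matrix_unit 1 2 \<in> word_span 1 {A, B} 4"
    using units subspace_word_span by (intro matrix.subspace_diff)
  then have "matrix_unit 2 3 \<in> word_span 1 {A, B} 4"
    by (simp add: A_def)
  then have "matrix_unit i j \<in> word_span 1 {A, B} 4" for i j
    using units exhaust_3[of i] exhaust_3[of j] by metis
  then have "matrix.span matrix_units \<subseteq> word_span 1 {A, B} 4"
    by (intro matrix.span_minimal subspace_word_span) (auto simp: matrix_units_def)
  then have UNIV4: "word_span 1 {A, B} 4 = UNIV"
    by (simp add: matrix.span_Basis top.extremum_unique)
  have gen: "generating_set {A, B}"
    unfolding generating_set_def using UNIV4 word_span_subset_gen_alg by blast

  \<comment> \<open>Among words of length at most 3, only \<open>A\<close> has a nonzero entry at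
    \<open>(1, 2)\<close> or \<open>(2, 3)\<close>, and there both entries are 1. This linear
    condition excludes \<open>matrix_unit 1 2\<close>.\<close>
  define T :: "('a^3^3) set" where "T = {M. M $ 1 $ 2 = M $ 2 $ 3}"
  have "word_span 1 {A, B} 3 \<subseteq> T"
  proof (rule word_span_leI)
    show "matrix.subspace T"
      by (rule matrix.subspaceI) (auto simp: T_def)
    fix ws assume ws: "set ws \<subseteq> {A, B}" "1 \<le> length ws" "length ws \<le> 3"
    then consider x where "ws = [x]" "x \<in> {A, B}"
      | x y where "ws = [x, y]" "x \<in> {A, B}" "y \<in> {A, B}"
      | x y z where "ws = [x, y, z]" "x \<in> {A, B}" "y \<in> {A, B}" "z \<in> {A, B}"
      by (cases ws; cases "tl ws"; cases "tl (tl ws)") auto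
    then show "word_prod ws \<in> T"
      by cases (auto simp: mult T_def matrix_unit_nth)
  qed
  moreover have "matrix_unit 1 2 \<notin> T"
    by (simp add: T_def matrix_unit_nth)
  ultimately have not_UNIV3: "word_span 1 {A, B} 3 \<noteq> UNIV"
    by blast
  have "4 \<le> l0 {A, B}"
  proof (rule ccontr)
    assume "\<not> 4 \<le> l0 {A, B}"
    then have k: "l0 {A, B} \<le> 3"
      by simp
    \<comment> \<open>\<open>LeastI\<close> needs a witness of stability, here 4. A least index of
      at most 3 would then trap the span at length 4 inside the one at length 3.\<close>
    have "L0 {A, B} 4 = L0 {A, B} (Suc 4)"
      unfolding L0_eq_word_span using UNIV4 word_span_mono[of 1 1 4 "Suc 4" "{A, B}"] by auto
    then have "L0 {A, B} (l0 {A, B}) = L0 {A, B} (Suc (l0 {A, B}))"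
      unfolding l0_def by (rule LeastI)
    then have stable: "word_span 1 {A, B} (Suc (l0 {A, B})) = word_span 1 {A, B} (l0 {A, B})"
      by (simp only: L0_eq_word_span)
    have "word_span 1 {A, B} 4 = word_span 1 {A, B} (l0 {A, B})"
      by (rule word_span_stable[OF _ stable]) (use k in simp_all)
    also have "\<dots> \<subseteq> word_span 1 {A, B} 3"
      using k by (intro word_span_mono) simp_all
    finally show False
      using UNIV4 not_UNIV3 by (simp only: top.extremum_unique)
  qed
  then have "l0 {A, B} = 4"
    using l0_le_4[OF gen] by simp
  then show ?thesis
    using gen by (intro exI[of _ "{A, B}"]) simp
qed

theorem mainTheorem4:
  "(\<exists>S :: ('a::field^3^3) set. finite S \<and> generating_set S \<and> l0 S = 4) \<and>
   (\<forall>S :: ('a::field^3^3) set. finite S \<and> generating_set S \<longrightarrow> l0 S \<le> 4)"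
  by (intro conjI allI impI exists_l0_eq_4 l0_le_4) simp

end
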